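(* Let $(X_n)_{n\ge0}$ be up-down chains on finite pairwise disjoint sets $(\mathbb S_n)_{n\ge0}$ with $\mathbb S_0=\{\varnothing\}$, whose up- and down-steps satisfy $p^\uparrow_np^\downarrow_{n+1}=\beta_np^\downarrow_np^\uparrow_{n-1}+(1-\beta_n)\mathrm{Id}$ for $n\ge1$ with $\beta_n\in(0,1)$, and let $(c_n)_{n\ge0}$ be positive numbers with $c_{n-1}/c_n=\beta_n$ for $n\ge1$. Suppose that for every $n\ge1$ there are $r_n,s_n\in\mathbb S_n$ such that $M_n(s_n)>0$ and $n=\min\{m\ge0:p_n^m(r_n,s_n)>0\}$. Then the separation distance $\Delta_n$ of $X_n$ and the separation distance $\Delta_n^*$ of its continuous-time variant with generator $c_n(T_n-I)$ are given by $$\Delta_n(m)=\sum_{i=0}^{n-1}\Big(1-\frac{c_i}{c_n}\Big)^m\prod_{\substack{0\le j\le n-1\\ j\ne i}}\frac{c_j}{c_j-c_i},\qquad m\ge0,\ n\ge1,$$ and $$\Delta^*_n(t)=\sum_{i=0}^{n-1}e^{-c_it}\prod_{\substack{0\le j\le n-1\\ j\ne i}}\frac{c_j}{c_j-c_i},\qquad t\ge0,\ n\ge1.$$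
   Context: Here $p^\uparrow_n$ ($n\ge0$) is a stochastic matrix from $\mathbb S_n$ to $\mathbb S_{n+1}$, $p^\downarrow_n$ ($n\ge1$) a stochastic matrix from $\mathbb S_n$ to $\mathbb S_{n-1}$, $X_n$ is the Markov chain on $\mathbb S_n$ with transition matrix $p_n=p^\uparrow_np^\downarrow_{n+1}$, $T_n$ is its transition operator $(T_nf)(r)=\sum_sp_n(r,s)f(s)$, and $M_n=(p^\uparrow_0\cdots p^\uparrow_{n-1})(\varnothing,\cdot)$ is the unique stationary distribution of $X_n$. The separation distances are $$\Delta_n(m)=\max_{r,s\in\mathbb S_n,\ M_n(s)\ne0}\Big(1-\frac{p_n^m(r,s)}{M_n(s)}\Big),\qquad \Delta^*_n(t)=\sup_{r\in\mathbb S_n,\ f:\mathbb S_n\to(0,\infty)}\Big(1-\frac{(e^{tc_n(T_n-I)}f)(r)}{\int f\,dM_n}\Big).$$ *)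

theory Defs
  imports Complex_Main "HOL-Library.FuncSet" "HOL-Library.Disjoint_Sets"
begin

text \<open>A matrix with rows indexed by a finite set \<open>A\<close> and columns indexed by a finite set
  \<open>B\<close> is a function \<open>'a \<Rightarrow> 'a \<Rightarrow> real\<close> of which only the entries in
  \<open>A \<times> B\<close> matter; index sets are passed explicitly wherever they are summed over.\<close>

definition stochastic_matrix :: "'a set \<Rightarrow> 'a set \<Rightarrow> ('a \<Rightarrow> 'a \<Rightarrow> real) \<Rightarrow> bool" where
  "stochastic_matrix A B p \<longleftrightarrow>
     (\<forall>r\<in>A. \<forall>s\<in>B. 0 \<le> p r s) \<and> (\<forall>r\<in>A. (\<Sum>s\<in>B. p r s) = 1)"

definition id_mat :: "'a \<Rightarrow> 'a \<Rightarrow> real" where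
  "id_mat r s = (if r = s then 1 else 0)"

text \<open>\<open>B\<close> is the common index set: the columns of \<open>p\<close> and the rows of \<open>q\<close>.\<close>

definition mat_prod ::
    "'a set \<Rightarrow> ('a \<Rightarrow> 'a \<Rightarrow> real) \<Rightarrow> ('a \<Rightarrow> 'a \<Rightarrow> real) \<Rightarrow> 'a \<Rightarrow> 'a \<Rightarrow> real" where
  "mat_prod B p q r s = (\<Sum>u\<in>B. p r u * q u s)"

primrec mat_pow :: "'a set \<Rightarrow> ('a \<Rightarrow> 'a \<Rightarrow> real) \<Rightarrow> nat \<Rightarrow> 'a \<Rightarrow> 'a \<Rightarrow> real" where
  "mat_pow A p 0 = id_mat"
| "mat_pow A p (Suc m) = mat_prod A (mat_pow A p m) p"

text \<open>In the following, \<open>S n\<close> are the state spaces, \<open>up n\<close> is the matrix of the up-step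
  from \<open>S n\<close> to \<open>S (Suc n)\<close>, and \<open>down n\<close> (used for \<open>n \<ge> 1\<close> only) that of the down-step
  from \<open>S n\<close> to \<open>S (n - 1)\<close>.\<close>

definition updown_matrix ::
    "(nat \<Rightarrow> 'a set) \<Rightarrow> (nat \<Rightarrow> 'a \<Rightarrow> 'a \<Rightarrow> real) \<Rightarrow> (nat \<Rightarrow> 'a \<Rightarrow> 'a \<Rightarrow> real)
      \<Rightarrow> nat \<Rightarrow> 'a \<Rightarrow> 'a \<Rightarrow> real" where
  "updown_matrix S up down n = mat_prod (S (Suc n)) (up n) (down (Suc n))"

primrec up_prod ::
    "(nat \<Rightarrow> 'a set) \<Rightarrow> (nat \<Rightarrow> 'a \<Rightarrow> 'a \<Rightarrow> real) \<Rightarrow> nat \<Rightarrow> 'a \<Rightarrow> 'a \<Rightarrow> real" where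
  "up_prod S up 0 = id_mat"
| "up_prod S up (Suc n) = mat_prod (S n) (up_prod S up n) (up n)"

text \<open>The stationary distribution \<open>M\<^sub>n\<close> of the up-down chain on \<open>S n\<close>, where \<open>e\<close> is the only
  element of \<open>S 0\<close>.\<close>

definition stat_dist ::
    "(nat \<Rightarrow> 'a set) \<Rightarrow> 'a \<Rightarrow> (nat \<Rightarrow> 'a \<Rightarrow> 'a \<Rightarrow> real) \<Rightarrow> nat \<Rightarrow> 'a \<Rightarrow> real" where
  "stat_dist S e up n s = up_prod S up n e s"

definition trans_op ::
    "'a set \<Rightarrow> ('a \<Rightarrow> 'a \<Rightarrow> real) \<Rightarrow> ('a \<Rightarrow> real) \<Rightarrow> 'a \<Rightarrow> real" where
  "trans_op A p f r = (\<Sum>s\<in>A. p r s * f s)"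

text \<open>The exponential of an operator on functions, as a pointwise power series. It is used below
  only for operators that act on functions on a finite set, where the series converges
  absolutely.\<close>

definition op_exp :: "(('a \<Rightarrow> real) \<Rightarrow> 'a \<Rightarrow> real) \<Rightarrow> ('a \<Rightarrow> real) \<Rightarrow> 'a \<Rightarrow> real" where
  "op_exp L f r = (\<Sum>k. (L ^^ k) f r / fact k)"

definition sep_dist ::
    "(nat \<Rightarrow> 'a set) \<Rightarrow> 'a \<Rightarrow> (nat \<Rightarrow> 'a \<Rightarrow> 'a \<Rightarrow> real) \<Rightarrow> (nat \<Rightarrow> 'a \<Rightarrow> 'a \<Rightarrow> real)
      \<Rightarrow> nat \<Rightarrow> nat \<Rightarrow> real" where
  "sep_dist S e up down n m =
     Max {1 - mat_pow (S n) (updown_matrix S up down n) m r s / stat_dist S e up n s | r s.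
            r \<in> S n \<and> s \<in> S n \<and> stat_dist S e up n s \<noteq> 0}"

text \<open>For \<open>t \<ge> 0\<close> the semigroup is positive, so the set below is bounded above by 1 and the
  supremum is a genuine one. The denominator is the integral of \<open>f\<close> with respect to \<open>M\<^sub>n\<close>.\<close>

definition sep_dist_cont ::
    "(nat \<Rightarrow> 'a set) \<Rightarrow> 'a \<Rightarrow> (nat \<Rightarrow> 'a \<Rightarrow> 'a \<Rightarrow> real) \<Rightarrow> (nat \<Rightarrow> 'a \<Rightarrow> 'a \<Rightarrow> real)
      \<Rightarrow> (nat \<Rightarrow> real) \<Rightarrow> nat \<Rightarrow> real \<Rightarrow> real" where
  "sep_dist_cont S e up down c n t =
     Sup {1 - op_exp (\<lambda>g x. t * c n * (trans_op (S n) (updown_matrix S up down n) g x - g x)) f r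
              / (\<Sum>s\<in>S n. f s * stat_dist S e up n s) | r f.
            r \<in> S n \<and> f \<in> S n \<rightarrow> {0<..}}"

end

(* Let Q_k be the kernel of going down from level n to level k and then up again to level n. The
   commutation relation gives Q_k (T_n - I) = (c_{k-1} / c_n) (Q_{k-1} - Q_k), so that p_n^m is the
   mixture of Q_0, ..., Q_n with the weights of a pure-death chain started in n and moving from k
   to k-1 with probability c_{k-1} / c_n; likewise in continuous time, with rates c_{k-1}. As
   Q_0(r, s) = M_n(s), the separation distance is at most the probability that the death chain has
   not been absorbed in 0. Equality holds at (r_n, s_n): since p_n^m(r_n, s_n) = 0 for m < n, all
   Q_k with k >= 1 vanish there. The weights are divided differences of the applied function at
   the eigenvalues of the generator, which yields the explicit formula. *)

theory Submission
  imports Defs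
begin

section \<open>Divided differences as weights of a death chain\<close>

text \<open>The divided difference of \<open>\<lambda>x. f (- x)\<close> at the nodes \<open>- d k, \<dots>, - d n\<close>, scaled by
  \<open>d (k + 1) \<cdots> d n\<close>: the weight of the state \<open>k\<close> in the death chain started in \<open>n\<close> with rates \<open>d\<close>,
  when \<open>f (- A)\<close> is formed for its generator \<open>A\<close>.\<close>

definition dd_coeff :: "(nat \<Rightarrow> real) \<Rightarrow> nat \<Rightarrow> (real \<Rightarrow> real) \<Rightarrow> nat \<Rightarrow> real" where
  "dd_coeff d n f k =
     (\<Sum>i=k..n. f (d i) * ((\<Prod>j\<in>{Suc k..n}. d j) / (\<Prod>j\<in>{k..n} - {i}. d j - d i)))"

lemma dd_coeff_eq_0: "k > n \<Longrightarrow> dd_coeff d n f k = 0"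
  by (simp add: dd_coeff_def)

lemma dd_coeff_add: "dd_coeff d n (\<lambda>x. f x + g x) k = dd_coeff d n f k + dd_coeff d n g k"
  by (simp add: dd_coeff_def sum.distrib distrib_right add_divide_distrib)

lemma dd_coeff_cmult: "dd_coeff d n (\<lambda>x. a * f x) k = a * dd_coeff d n f k"
  by (simp add: dd_coeff_def sum_distrib_left mult.assoc)

text \<open>The factor \<open>d k - x\<close> kills the term \<open>i = k\<close> and cancels one
  factor of every other denominator. For the death chain this is the forward equation:
  \<open>k\<close> is left at rate \<open>d k\<close> and entered from \<open>Suc k\<close> at rate
  \<open>d (Suc k)\<close>.\<close>

lemma dd_coeff_times_ident:
  assumes "inj d"
  shows "dd_coeff d n (\<lambda>x. x * f x) k = d k * dd_coeff d n f k - d (Suc k) * dd_coeff d n f (Suc k)"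
proof (cases "k \<le> n")
  case True
  define w where "w k i = (\<Prod>j\<in>{Suc k..n}. d j) / (\<Prod>j\<in>{k..n} - {i}. d j - d i)" for k i
  have w: "(d k - d i) * w k i = d (Suc k) * w (Suc k) i" if "i \<in> {Suc k..n}" for i
  proof -
    have "{k..n} - {i} = insert k ({Suc k..n} - {i})" using that by auto
    moreover have "d k \<noteq> d i" using that injD[OF assms, of k i] by auto
    moreover have "(\<Prod>j\<in>{Suc k..n}. d j) = d (Suc k) * (\<Prod>j\<in>{Suc (Suc k)..n}. d j)"
      using that by (intro prod.atLeast_Suc_atMost) auto
    ultimately show ?thesis by (simp add: w_def)
  qed
  have "d k * dd_coeff d n f k - dd_coeff d n (\<lambda>x. x * f x) k
      = (\<Sum>i=k..n. f (d i) * ((d k - d i) * w k i))"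
    by (simp add: dd_coeff_def w_def[symmetric] sum_distrib_left sum_subtractf[symmetric]
        algebra_simps)
  also have "\<dots> = (\<Sum>i=Suc k..n. f (d i) * ((d k - d i) * w k i))"
    using True by (simp add: sum.atLeast_Suc_atMost)
  also have "\<dots> = (\<Sum>i=Suc k..n. f (d i) * (d (Suc k) * w (Suc k) i))"
    using w by simp
  also have "\<dots> = d (Suc k) * dd_coeff d n f (Suc k)"
    by (simp add: dd_coeff_def w_def sum_distrib_left mult_ac)
  finally show ?thesis by simp
qed (simp add: dd_coeff_eq_0)

text \<open>Serves both time scales: \<open>a = 1\<close>, \<open>b = 1 / c n\<close> is a step of
  the discrete death chain, \<open>a = 0\<close>, \<open>b = t\<close> an application of
  \<open>t\<close> times the generator.\<close>

lemma dd_coeff_affine_times: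
  assumes "inj d"
  shows "dd_coeff d n (\<lambda>x. (a - b * x) * f x) k
      = (a - b * d k) * dd_coeff d n f k + b * d (Suc k) * dd_coeff d n f (Suc k)"
proof -
  have "dd_coeff d n (\<lambda>x. (a - b * x) * f x) k
      = dd_coeff d n (\<lambda>x. a * f x + - b * (x * f x)) k"
    by (simp add: algebra_simps)
  also have "\<dots> = a * dd_coeff d n f k - b * dd_coeff d n (\<lambda>x. x * f x) k"
    by (simp only: dd_coeff_add dd_coeff_cmult)
  finally show ?thesis
    by (simp add: dd_coeff_times_ident[OF assms] algebra_simps)
qed

text \<open>Multiplying by \<open>d n - d k = (d n - d i) - (d k - d i)\<close> expresses the divided difference of the
  constant 1 over \<open>{k..n}\<close> through those over \<open>{Suc k..n}\<close> and \<open>{k..n - 1}\<close>.\<close>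

lemma sum_inverse_prod_diff_eq_0:
  fixes d :: "nat \<Rightarrow> real"
  assumes "inj d" "k < n"
  shows "(\<Sum>i=k..n. 1 / (\<Prod>j\<in>{k..n} - {i}. d j - d i)) = 0"
  using assms(2)
proof (induction "n - k" arbitrary: k n)
  case 0
  then show ?case by simp
next
  case (Suc l)
  define g where "g k n i = 1 / (\<Prod>j\<in>{k..n} - {i}. d j - d i)" for k n i
  obtain N where N: "n = Suc N" using Suc.prems by (cases n) auto
  have ne: "d i \<noteq> d j" if "i \<noteq> j" for i j using injD[OF assms(1)] that by blast
  have left: "g k N i = (d n - d i) * g k n i" if "i \<in> {k..N}" for i
  proof -
    have "{k..n} - {i} = insert n ({k..N} - {i})" using that N by auto
    then show ?thesis using ne[of n i] that N by (simp add: g_def)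
  qed
  have right: "g (Suc k) n i = (d k - d i) * g k n i" if "i \<in> {Suc k..n}" for i
  proof -
    have "{k..n} - {i} = insert k ({Suc k..n} - {i})" using that by auto
    then show ?thesis using ne[of k i] that by (simp add: g_def)
  qed
  \<comment> \<open>Extending both sums to \<open>{k..n}\<close> adds only a zero term, with factor
    \<open>d n - d n\<close> or \<open>d k - d k\<close>.\<close>
  have "(\<Sum>i=k..N. g k N i) = (\<Sum>i=k..n. (d n - d i) * g k n i)"
    using left Suc.prems N by simp
  moreover have "(\<Sum>i=Suc k..n. g (Suc k) n i) = (\<Sum>i=k..n. (d k - d i) * g k n i)"
    using right Suc.prems by (simp add: sum.atLeast_Suc_atMost[of k n])
  ultimately have diff: "(\<Sum>i=k..N. g k N i) - (\<Sum>i=Suc k..n. g (Suc k) n i)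
      = (d n - d k) * (\<Sum>i=k..n. g k n i)"
    by (simp add: sum_distrib_left sum_subtractf[symmetric] algebra_simps)
  \<comment> \<open>Both sums vanish by induction unless \<open>k = N\<close>, where each is a
    single term with an empty product.\<close>
  have "(\<Sum>i=k..N. g k N i) = (\<Sum>i=Suc k..n. g (Suc k) n i)"
  proof (cases "k = N")
    case True
    then show ?thesis using N by (simp add: g_def)
  next
    case False
    then show ?thesis using Suc.hyps(1)[of N k] Suc.hyps(1)[of n "Suc k"] Suc.hyps(2) Suc.prems N
      by (simp add: g_def)
  qed
  then have "(\<Sum>i=k..n. g k n i) = 0" using diff ne[of n k] Suc.prems by simp
  then show ?case by (simp add: g_def)
qed

text \<open>Initial condition: with no time elapsed, the death chain sits in its start
  \<open>n\<close>. A divided difference of a constant over two or more nodes is 0.\<close>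

lemma dd_coeff_one:
  assumes "inj d" "k \<le> n"
  shows "dd_coeff d n (\<lambda>_. 1) k = (if k = n then 1 else 0)"
proof (cases "k = n")
  case False
  have "dd_coeff d n (\<lambda>_. 1) k
      = (\<Prod>j\<in>{Suc k..n}. d j) * (\<Sum>i=k..n. 1 / (\<Prod>j\<in>{k..n} - {i}. d j - d i))"
    by (simp add: dd_coeff_def sum_distrib_left)
  then show ?thesis using sum_inverse_prod_diff_eq_0[OF assms(1), of k n] False assms(2) by simp
qed (simp add: dd_coeff_def)

text \<open>The node \<open>d 0 = 0\<close> contributes \<open>f 0\<close> with weight 1. At the
  node \<open>c i\<close>, the factor \<open>d 0 - c i\<close> cancels \<open>c i\<close> in the
  numerator and brings the minus sign.\<close>

lemma dd_coeff_zero: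
  fixes c :: "nat \<Rightarrow> real"
  assumes "\<And>i. c i > 0" "n \<ge> 1"
  shows "dd_coeff (case_nat 0 c) n f 0
      = f 0 - (\<Sum>i=0..n-1. f (c i) * (\<Prod>j\<in>{0..n-1} - {i}. c j / (c j - c i)))"
proof -
  obtain N where N: "n = Suc N" using assms(2) by (cases n) auto
  define d where "d = case_nat 0 c"
  have d: "d 0 = 0" "d (Suc i) = c i" for i by (simp_all add: d_def)
  have c_ne: "c i \<noteq> 0" for i using assms(1)[of i] by simp
  have shift: "(\<Prod>j\<in>{Suc 0..n}. d j) = (\<Prod>j\<in>{0..N}. c j)"
    unfolding N by (subst prod.shift_bounds_cl_Suc_ivl) (simp add: d)
  have first: "(\<Prod>j\<in>{0..n} - {0}. d j - d 0) = (\<Prod>j\<in>{0..N}. c j)"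
  proof -
    have "{0..n} - {0} = {Suc 0..n}" by auto
    then show ?thesis using shift by (simp add: d)
  qed
  have rest: "(\<Prod>j\<in>{0..n} - {Suc i}. d j - d (Suc i)) = - c i * (\<Prod>j\<in>{0..N} - {i}. c j - c i)"
    for i
  proof -
    have "{0..n} - {Suc i} = insert 0 (Suc ` ({0..N} - {i}))"
      unfolding N atLeast0AtMost by (auto simp: atMost_Suc_eq_insert_0)
    then show ?thesis by (simp add: prod.reindex d)
  qed
  have quot: "(\<Prod>j\<in>{0..N}. c j) / (- c i * (\<Prod>j\<in>{0..N} - {i}. c j - c i))
      = - (\<Prod>j\<in>{0..N} - {i}. c j / (c j - c i))" if "i \<in> {0..N}" for i
  proof -
    have "(\<Prod>j\<in>{0..N}. c j) = c i * (\<Prod>j\<in>{0..N} - {i}. c j)"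
      using that by (simp add: prod.remove)
    then show ?thesis using c_ne[of i] by (simp add: prod_dividef)
  qed
  have "dd_coeff d n f 0 = f 0 + (\<Sum>i=0..N. f (c i) *
      ((\<Prod>j\<in>{0..N}. c j) / (- c i * (\<Prod>j\<in>{0..N} - {i}. c j - c i))))"
    unfolding dd_coeff_def shift
    by (subst sum.atLeast_Suc_atMost, simp, unfold first, unfold N sum.shift_bounds_cl_Suc_ivl,
        unfold N[symmetric] rest) (simp add: d c_ne)
  also have "\<dots> = f 0 - (\<Sum>i=0..N. f (c i) * (\<Prod>j\<in>{0..N} - {i}. c j / (c j - c i)))"
    using quot by (simp add: sum_negf[symmetric] del: mult_minus_left)
  finally show ?thesis by (simp add: d_def N)
qed

lemma sum_atMost_split_0:
  fixes n :: nat
  shows "(\<Sum>k\<le>n. a k * q k) = a 0 * q 0 + (\<Sum>k=1..n. a k * (q k::real))"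
proof -
  have "{..n} = insert 0 {1..n}" by auto
  then show ?thesis by simp
qed

section \<open>Matrix products over explicit index sets\<close>

lemma mat_prod_assoc: "mat_prod B (mat_prod A p q) r = mat_prod A p (mat_prod B q r)"
proof (intro ext)
  fix a b
  show "mat_prod B (mat_prod A p q) r a b = mat_prod A p (mat_prod B q r) a b"
    unfolding mat_prod_def sum_distrib_left sum_distrib_right
    by (subst sum.swap) (simp add: mult.assoc)
qed

lemma mat_prod_cong:
  "(\<And>u. u \<in> B \<Longrightarrow> p r u = p' r u) \<Longrightarrow> (\<And>u. u \<in> B \<Longrightarrow> q u s = q' u s)
    \<Longrightarrow> mat_prod B p q r s = mat_prod B p' q' r s"
  by (simp add: mat_prod_def)

lemma sum_id_mat:
  assumes "finite B" "r \<in> B"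
  shows "(\<Sum>u\<in>B. id_mat r u * f u) = f r"
proof -
  have "(\<Sum>u\<in>B. id_mat r u * f u) = (\<Sum>u\<in>B. if u = r then f u else 0)"
    by (intro sum.cong) (auto simp: id_mat_def)
  then show ?thesis using assms by simp
qed

lemma id_mat_commute: "id_mat r s = id_mat s r"
  by (simp add: id_mat_def)

lemma mat_prod_id_right: "finite B \<Longrightarrow> s \<in> B \<Longrightarrow> mat_prod B p id_mat r s = p r s"
  using sum_id_mat[of B s "p r"] by (simp add: mat_prod_def id_mat_commute[of s] mult.commute)

lemma mat_prod_id_left: "finite B \<Longrightarrow> r \<in> B \<Longrightarrow> mat_prod B id_mat p r s = p r s"
  by (simp add: mat_prod_def sum_id_mat)

lemma mat_prod_affine_right:
  "mat_prod B p (\<lambda>x y. a * q x y + b * q' x y) r s = a * mat_prod B p q r s + b * mat_prod B p q' r s"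
  by (simp add: mat_prod_def sum_distrib_left sum.distrib[symmetric] algebra_simps)

lemma mat_prod_affine_left:
  "mat_prod B (\<lambda>x y. a * p x y + b * p' x y) q r s = a * mat_prod B p q r s + b * mat_prod B p' q r s"
  by (simp add: mat_prod_def sum_distrib_left sum.distrib[symmetric] algebra_simps)

lemma mat_prod_nonneg:
  "(\<And>u. u \<in> B \<Longrightarrow> 0 \<le> p r u) \<Longrightarrow> (\<And>u. u \<in> B \<Longrightarrow> 0 \<le> q u s) \<Longrightarrow> 0 \<le> mat_prod B p q r s"
  by (simp add: mat_prod_def sum_nonneg)

section \<open>Kernels going down and up again, and the commutation relation\<close>

text \<open>\<open>down_up S up down n k\<close> walks from level \<open>n\<close> down to level \<open>k\<close> and up again; its junk value for
  \<open>k > n\<close> is the identity.\<close>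

primrec down_up ::
    "(nat \<Rightarrow> 'a set) \<Rightarrow> (nat \<Rightarrow> 'a \<Rightarrow> 'a \<Rightarrow> real) \<Rightarrow> (nat \<Rightarrow> 'a \<Rightarrow> 'a \<Rightarrow> real)
      \<Rightarrow> nat \<Rightarrow> nat \<Rightarrow> 'a \<Rightarrow> 'a \<Rightarrow> real" where
  "down_up S up down 0 k = id_mat"
| "down_up S up down (Suc n) k =
     (if k \<le> n then mat_prod (S n) (mat_prod (S n) (down (Suc n)) (down_up S up down n k)) (up n)
      else id_mat)"

lemma down_up_self: "down_up S up down n n = id_mat"
  by (cases n) auto

locale updown_chain =
  fixes S :: "nat \<Rightarrow> 'a set"
    and e :: 'a
    and up down :: "nat \<Rightarrow> 'a \<Rightarrow> 'a \<Rightarrow> real"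
    and \<beta> c :: "nat \<Rightarrow> real"
  assumes fin: "finite (S n)"
    and S_0: "S 0 = {e}"
    and up: "stochastic_matrix (S n) (S (Suc n)) (up n)"
    and down: "stochastic_matrix (S (Suc n)) (S n) (down (Suc n))"
    and \<beta>: "0 < \<beta> (Suc n)" "\<beta> (Suc n) < 1"
    and commute: "r \<in> S (Suc n) \<Longrightarrow> s \<in> S (Suc n) \<Longrightarrow>
           updown_matrix S up down (Suc n) r s
             = \<beta> (Suc n) * mat_prod (S n) (down (Suc n)) (up n) r s + (1 - \<beta> (Suc n)) * id_mat r s"
    and c_pos: "c n > 0"
    and c_ratio: "c n = \<beta> (Suc n) * c (Suc n)"
begin

abbreviation "T \<equiv> updown_matrix S up down"
abbreviation "Q \<equiv> down_up S up down"
abbreviation "M \<equiv> stat_dist S e up"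
abbreviation "d \<equiv> case_nat 0 c"

text \<open>The bounds on \<open>\<beta>\<close> enter here. They make the nodes distinct and, for
  \<open>k \<le> n\<close>, the quotients \<open>d k / c n\<close> probabilities.\<close>

lemma strict_mono_c: "strict_mono c"
unfolding strict_mono_Suc_iff
proof
  fix n show "c n < c (Suc n)"
    using c_ratio[of n] \<beta>[of n] c_pos[of "Suc n"] by simp
qed

lemma strict_mono_d: "strict_mono d"
  using strict_mono_c c_pos by (simp add: strict_mono_Suc_iff split: nat.split)

lemma inj_d: "inj d"
  by (rule strict_mono_imp_inj_on[OF strict_mono_d])

lemma d_nonneg: "d k \<ge> 0"
  using c_pos by (simp add: less_imp_le split: nat.split)

lemma d_le_c: "k \<le> n \<Longrightarrow> d k \<le> c n"
  using strict_mono_less_eq[OF strict_mono_d, of k "Suc n"] by simp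

text \<open>Base of the induction over levels: the commutation relation starts at level 1, but from
  the one-point level 0 an up-step and a down-step always return.\<close>

lemma T_0: "r \<in> S 0 \<Longrightarrow> s \<in> S 0 \<Longrightarrow> T 0 r s = 1"
  using down[of 0] up[of 0]
  by (simp add: S_0 updown_matrix_def mat_prod_def stochastic_matrix_def)

text \<open>Appending a step of the chain to \<open>Q n k\<close> acts like a step of a pure-death chain on \<open>k\<close>. Here \<open>d\<close>
  is \<open>c\<close> shifted by one, so that the state 0 is absorbing.\<close>

lemma down_up_updown:
  assumes "k \<le> n" "r \<in> S n" "s \<in> S n"
  shows "mat_prod (S n) (Q n k) (T n) r s
      = (1 - d k / c n) * Q n k r s + d k / c n * Q n (k - 1) r s"
  using assms
proof (induction n arbitrary: k r s)
  case 0
  then show ?case by (simp add: mat_prod_def T_0 S_0 id_mat_def)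
next
  case (Suc n)
  note fin [simp]
  have c: "c n / c (Suc n) = \<beta> (Suc n)" using c_ratio[of n] c_pos[of "Suc n"] by simp
  show ?case
  proof (cases "k = Suc n")
    \<comment> \<open>The kernel is the identity here, and the claim is the commutation relation
      with \<open>\<beta> (Suc n) = d (Suc n) / c (Suc n)\<close>.\<close>
    case True
    have "Q (Suc n) n r s = mat_prod (S n) (down (Suc n)) (up n) r s"
      by (simp add: down_up_self mat_prod_assoc) (intro mat_prod_cong, simp_all add: mat_prod_id_left)
    with True show ?thesis using Suc.prems
      by (simp add: mat_prod_id_left commute c down_up_self del: down_up.simps)
  next
    case False
    then have k: "k \<le> n" using Suc.prems by simp
    \<comment> \<open>Commutation moves the step of the chain past the final up-step; at level
      \<open>n\<close> it becomes a lazy step.\<close>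
    have comm: "mat_prod (S (Suc n)) (up n) (T (Suc n)) u s
        = mat_prod (S n) (\<lambda>x y. \<beta> (Suc n) * T n x y + (1 - \<beta> (Suc n)) * id_mat x y) (up n) u s"
      if "u \<in> S n" for u
    proof -
      have "mat_prod (S (Suc n)) (up n) (T (Suc n)) u s = mat_prod (S (Suc n)) (up n)
          (\<lambda>x y. \<beta> (Suc n) * mat_prod (S n) (down (Suc n)) (up n) x y
            + (1 - \<beta> (Suc n)) * id_mat x y) u s"
        using Suc.prems commute by (intro mat_prod_cong) auto
      then show ?thesis using Suc.prems that
        by (simp add: mat_prod_affine_right mat_prod_affine_left mat_prod_id_left mat_prod_id_right
            mat_prod_assoc[symmetric] updown_matrix_def)
    qed
    \<comment> \<open>Laziness turns \<open>d k / c n\<close> into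
      \<open>d k / c (Suc n)\<close>.\<close>
    have ih: "mat_prod (S n) (Q n k) (\<lambda>x y. \<beta> (Suc n) * T n x y + (1 - \<beta> (Suc n)) * id_mat x y) u v
        = (1 - d k / c (Suc n)) * Q n k u v + d k / c (Suc n) * Q n (k - 1) u v"
      if "u \<in> S n" "v \<in> S n" for u v
      using Suc.IH[OF k that] that c_ratio[of n] \<beta>[of n] c_pos[of "Suc n"]
      unfolding mat_prod_affine_right by (simp add: mat_prod_id_right) (simp add: field_simps)
    have "mat_prod (S (Suc n)) (Q (Suc n) k) (T (Suc n)) r s
        = mat_prod (S n) (mat_prod (S n) (down (Suc n)) (Q n k))
            (mat_prod (S (Suc n)) (up n) (T (Suc n))) r s"
      using k by (simp add: mat_prod_assoc)
    also have "\<dots> = mat_prod (S n) (mat_prod (S n) (down (Suc n)) (Q n k))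
        (mat_prod (S n) (\<lambda>x y. \<beta> (Suc n) * T n x y + (1 - \<beta> (Suc n)) * id_mat x y) (up n)) r s"
      using comm by (intro mat_prod_cong) auto
    also have "\<dots> = mat_prod (S n) (mat_prod (S n) (down (Suc n)) (mat_prod (S n) (Q n k)
        (\<lambda>x y. \<beta> (Suc n) * T n x y + (1 - \<beta> (Suc n)) * id_mat x y))) (up n) r s"
      by (simp add: mat_prod_assoc)
    also have "\<dots> = mat_prod (S n) (mat_prod (S n) (down (Suc n))
        (\<lambda>x y. (1 - d k / c (Suc n)) * Q n k x y + d k / c (Suc n) * Q n (k - 1) x y)) (up n) r s"
      using ih by (intro mat_prod_cong) auto
    also have "\<dots> = (1 - d k / c (Suc n)) * Q (Suc n) k r s + d k / c (Suc n) * Q (Suc n) (k - 1) r s"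
    proof -
      have "mat_prod (S n) (down (Suc n))
          (\<lambda>x y. (1 - d k / c (Suc n)) * Q n k x y + d k / c (Suc n) * Q n (k - 1) x y)
        = (\<lambda>x y. (1 - d k / c (Suc n)) * mat_prod (S n) (down (Suc n)) (Q n k) x y
            + d k / c (Suc n) * mat_prod (S n) (down (Suc n)) (Q n (k - 1)) x y)"
        by (intro ext) (rule mat_prod_affine_right)
      moreover have "k - 1 \<le> n" using k by simp
      ultimately show ?thesis using k by (simp only: mat_prod_affine_left down_up.simps if_True)
    qed
    finally show ?thesis .
  qed
qed

lemma stat_dist_nonneg: "s \<in> S n \<Longrightarrow> 0 \<le> M n s"
proof (induction n arbitrary: s)
  case (Suc n)
  then show ?case using up[of n]
    by (auto simp: stat_dist_def stochastic_matrix_def intro!: mat_prod_nonneg)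
qed (simp add: stat_dist_def id_mat_def)

lemma down_up_nonneg: "r \<in> S n \<Longrightarrow> s \<in> S n \<Longrightarrow> 0 \<le> Q n k r s"
proof (induction n arbitrary: r s)
  case (Suc n)
  then show ?case using up[of n] down[of n]
    by (auto simp: stochastic_matrix_def id_mat_def intro!: mat_prod_nonneg)
qed (simp add: id_mat_def)

text \<open>Walking down to the one-point level forgets the start: in the induction, the rows of
  \<open>down\<close> just sum to 1.\<close>

lemma down_up_0: "r \<in> S n \<Longrightarrow> s \<in> S n \<Longrightarrow> Q n 0 r s = M n s"
proof (induction n arbitrary: r s)
  case 0
  then show ?case by (simp add: stat_dist_def S_0)
next
  case (Suc n)
  have "mat_prod (S n) (down (Suc n)) (Q n 0) r v = M n v" if "v \<in> S n" for v
    using Suc down[of n] that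
    by (simp add: mat_prod_def stochastic_matrix_def sum_distrib_right[symmetric])
  then show ?case by (simp add: stat_dist_def mat_prod_def)
qed

section \<open>Mixture representation in discrete time\<close>

text \<open>An index shift whose boundary terms vanish: \<open>d 0 = 0\<close>, which also makes
  \<open>0 - 1 = 0\<close> harmless, and \<open>dd_coeff d n f (Suc n) = 0\<close>.\<close>

lemma sum_dd_coeff_shift:
  "(\<Sum>k\<le>n. dd_coeff d n f k * (d k * q (k - 1))) = (\<Sum>k\<le>n. d (Suc k) * dd_coeff d n f (Suc k) * q k)"
proof -
  have "(\<Sum>k\<le>n. dd_coeff d n f k * (d k * q (k - 1)))
      = (\<Sum>k<n. d (Suc k) * dd_coeff d n f (Suc k) * q k)"
    by (simp add: sum.atMost_shift algebra_simps)
  also have "\<dots> = (\<Sum>k\<le>n. d (Suc k) * dd_coeff d n f (Suc k) * q k)"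
    by (simp add: lessThan_Suc_atMost[symmetric] dd_coeff_eq_0)
  finally show ?thesis .
qed

text \<open>Duality: a step on the kernels is a step on the weights. Later \<open>q k\<close> is an
  entry of \<open>Q n k\<close> in discrete time and \<open>Q n k\<close> applied to a function in
  continuous time.\<close>

lemma sum_dd_coeff_affine:
  "(\<Sum>k\<le>n. dd_coeff d n f k * ((a - b * d k) * q k + b * d k * q (k - 1)))
    = (\<Sum>k\<le>n. dd_coeff d n (\<lambda>x. (a - b * x) * f x) k * q k)"
proof -
  have "(\<Sum>k\<le>n. dd_coeff d n f k * ((a - b * d k) * q k + b * d k * q (k - 1)))
      = (\<Sum>k\<le>n. (a - b * d k) * dd_coeff d n f k * q k)
        + b * (\<Sum>k\<le>n. dd_coeff d n f k * (d k * q (k - 1)))"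
    by (simp add: sum_distrib_left sum.distrib[symmetric] algebra_simps)
  then show ?thesis unfolding sum_dd_coeff_shift dd_coeff_affine_times[OF inj_d]
    by (simp add: sum_distrib_left sum.distrib[symmetric] algebra_simps)
qed

lemma sum_dd_coeff_one: "(\<Sum>k\<le>n. dd_coeff d n (\<lambda>_. 1) k * q k) = q n"
proof -
  have "(\<Sum>k\<le>n. dd_coeff d n (\<lambda>_. 1) k * q k) = (\<Sum>k\<le>n. if k = n then q k else 0)"
    by (intro sum.cong) (auto simp: dd_coeff_one[OF inj_d])
  then show ?thesis by simp
qed

text \<open>One step of the death chain is \<open>I + A / c n\<close>, where its generator
  \<open>A\<close> has the eigenvalues \<open>- d k\<close>; hence the function
  \<open>(1 - x / c n) ^ m\<close>.\<close>

lemma mat_pow_updown: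
  assumes "r \<in> S n" "s \<in> S n"
  shows "mat_pow (S n) (T n) m r s = (\<Sum>k\<le>n. dd_coeff d n (\<lambda>x. (1 - x / c n) ^ m) k * Q n k r s)"
  using assms(2)
proof (induction m arbitrary: s)
  case 0
  then show ?case by (simp add: sum_dd_coeff_one down_up_self)
next
  case (Suc m)
  define a where "a = dd_coeff d n (\<lambda>x. (1 - x / c n) ^ m)"
  have "mat_pow (S n) (T n) (Suc m) r s = (\<Sum>u\<in>S n. (\<Sum>k\<le>n. a k * Q n k r u) * T n u s)"
    using Suc.IH by (simp add: mat_prod_def a_def)
  also have "\<dots> = (\<Sum>k\<le>n. a k * mat_prod (S n) (Q n k) (T n) r s)"
    unfolding mat_prod_def sum_distrib_left sum_distrib_right
    by (subst sum.swap) (simp add: mult.assoc)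
  also have "\<dots> = (\<Sum>k\<le>n. a k *
      ((1 - 1 / c n * d k) * Q n k r s + 1 / c n * d k * Q n (k - 1) r s))"
    using assms Suc.prems by (intro sum.cong) (auto simp: down_up_updown)
  also have "\<dots> = (\<Sum>k\<le>n. dd_coeff d n (\<lambda>x. (1 - 1 / c n * x) * (1 - x / c n) ^ m) k * Q n k r s)"
    unfolding a_def by (rule sum_dd_coeff_affine)
  finally show ?case by simp
qed

text \<open>The recursion in \<open>m\<close> has nonnegative coefficients because
  \<open>d k \<le> c n\<close>.\<close>

lemma dd_coeff_power_nonneg: "k \<le> n \<Longrightarrow> 0 \<le> dd_coeff d n (\<lambda>x. (1 - x / c n) ^ m) k"
proof (induction m arbitrary: k)
  case 0
  then show ?case by (simp add: dd_coeff_one[OF inj_d])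
next
  case (Suc m)
  have "0 \<le> dd_coeff d n (\<lambda>x. (1 - x / c n) ^ m) (Suc k)"
    using Suc by (cases "k = n") (auto simp: dd_coeff_eq_0)
  moreover have "0 \<le> 1 - 1 / c n * d k"
    using d_le_c[OF Suc.prems] c_pos[of n] by simp
  ultimately show ?case
    using dd_coeff_affine_times[OF inj_d, of n 1 "1 / c n" "\<lambda>x. (1 - x / c n) ^ m" k]
      Suc d_nonneg[of "Suc k"] c_pos[of n] by (simp add: less_imp_le)
qed

text \<open>The path that moves down at every step has positive probability, as
  \<open>d (Suc k) > 0\<close>.\<close>

lemma dd_coeff_power_pos: "m \<le> n \<Longrightarrow> 0 < dd_coeff d n (\<lambda>x. (1 - x / c n) ^ m) (n - m)"
proof (induction m)
  case 0
  then show ?case by (simp add: dd_coeff_one[OF inj_d])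
next
  case (Suc m)
  define k where "k = n - Suc m"
  have k: "Suc k = n - m" "k \<le> n" using Suc.prems by (auto simp: k_def)
  have "0 \<le> 1 - 1 / c n * d k" using d_le_c[OF k(2)] c_pos[of n] by simp
  then have "0 \<le> (1 - 1 / c n * d k) * dd_coeff d n (\<lambda>x. (1 - x / c n) ^ m) k"
    using dd_coeff_power_nonneg[OF k(2)] by simp
  moreover have "0 < 1 / c n * d (Suc k) * dd_coeff d n (\<lambda>x. (1 - x / c n) ^ m) (Suc k)"
    using Suc c_pos by (intro mult_pos_pos) (simp_all add: k(1)[symmetric])
  ultimately show ?case
    using dd_coeff_affine_times[OF inj_d, of n 1 "1 / c n" "\<lambda>x. (1 - x / c n) ^ m" k]
    by (simp add: k_def)
qed

section \<open>Exponential weights and the continuous-time semigroup\<close>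

lemma dd_coeff_sums:
  assumes "\<And>x. (\<lambda>m. f m x) sums g x"
  shows "(\<lambda>m. dd_coeff d n (f m) k) sums dd_coeff d n g k"
  unfolding dd_coeff_def by (intro sums_sum sums_mult2 assms)

lemma sums_exp: "(\<lambda>m. x ^ m / fact m) sums exp (x::real)"
  using exp_converges[of x] by (simp add: divide_inverse mult.commute)

text \<open>Uniformization: \<open>exp (- t x)\<close> is a mixture of the powers \<open>(1 - x / c n) ^ m\<close> with Poisson
  weights.\<close>

lemma dd_coeff_exp_nonneg:
  assumes "k \<le> n" "t \<ge> 0"
  shows "0 \<le> dd_coeff d n (\<lambda>x. exp (- (t * x))) k"
proof -
  define w where "w m = exp (- (t * c n)) * (t * c n) ^ m / fact m" for m
  have sums: "(\<lambda>m. w m * (1 - x / c n) ^ m) sums exp (- (t * x))" for x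
  proof -
    have "(\<lambda>m. exp (- (t * c n)) * ((t * c n * (1 - x / c n)) ^ m / fact m))
        sums (exp (- (t * c n)) * exp (t * c n * (1 - x / c n)))"
      by (intro sums_mult sums_exp)
    moreover have "- (t * c n) + t * c n * (1 - x / c n) = - (t * x)"
      using c_pos[of n] by (simp add: field_simps)
    ultimately show ?thesis
      by (simp add: w_def power_mult_distrib exp_add[symmetric] mult.assoc)
  qed
  have "(\<lambda>m. dd_coeff d n (\<lambda>x. w m * (1 - x / c n) ^ m) k)
      sums dd_coeff d n (\<lambda>x. exp (- (t * x))) k"
    by (rule dd_coeff_sums[where f = "\<lambda>m x. w m * (1 - x / c n) ^ m"]) (rule sums)
  then have "(\<lambda>m. w m * dd_coeff d n (\<lambda>x. (1 - x / c n) ^ m) k)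
      sums dd_coeff d n (\<lambda>x. exp (- (t * x))) k"
    by (simp only: dd_coeff_cmult)
  moreover have "0 \<le> w m * dd_coeff d n (\<lambda>x. (1 - x / c n) ^ m) k" for m
    using dd_coeff_power_nonneg[OF assms(1)] assms(2) c_pos[of n] by (simp add: w_def less_imp_le)
  ultimately show ?thesis
    by (rule sums_le[OF _ sums_zero, rotated])
qed

abbreviation generator :: "nat \<Rightarrow> real \<Rightarrow> ('a \<Rightarrow> real) \<Rightarrow> 'a \<Rightarrow> real" where
  "generator n t \<equiv> \<lambda>g x. t * c n * (trans_op (S n) (T n) g x - g x)"

lemma funpow_generator:
  assumes "r \<in> S n"
  shows "(generator n t ^^ m) f r
      = (\<Sum>k\<le>n. dd_coeff d n (\<lambda>x. (- (t * x)) ^ m) k * trans_op (S n) (Q n k) f r)"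
proof (induction m arbitrary: f)
  case 0
  then show ?case using assms
    by (simp add: sum_dd_coeff_one down_up_self trans_op_def sum_id_mat fin)
next
  case (Suc m)
  \<comment> \<open>Subtracting the identity and multiplying by \<open>t * c n\<close> turns the
    probabilities \<open>d k / c n\<close> into \<open>t * d k\<close>.\<close>
  have step: "trans_op (S n) (Q n k) (generator n t f) r
      = (0 - t * d k) * trans_op (S n) (Q n k) f r + t * d k * trans_op (S n) (Q n (k - 1)) f r"
    if "k \<le> n" for k
  proof -
    have "trans_op (S n) (Q n k) (trans_op (S n) (T n) f) r
        = trans_op (S n) (mat_prod (S n) (Q n k) (T n)) f r"
      unfolding trans_op_def mat_prod_def sum_distrib_left sum_distrib_right
      by (subst sum.swap) (simp add: mult.assoc)
    also have "\<dots> = (\<Sum>s\<in>S n. ((1 - d k / c n) * Q n k r s + d k / c n * Q n (k - 1) r s) * f s)"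
      using assms that by (simp add: trans_op_def down_up_updown)
    also have "\<dots> = (1 - d k / c n) * trans_op (S n) (Q n k) f r
        + d k / c n * trans_op (S n) (Q n (k - 1)) f r"
      by (simp add: trans_op_def sum_distrib_left sum.distrib[symmetric] distrib_right mult.assoc)
    finally have *: "trans_op (S n) (Q n k) (trans_op (S n) (T n) f) r = \<dots>" .
    have "trans_op (S n) (Q n k) (generator n t f) r
        = t * c n * (trans_op (S n) (Q n k) (trans_op (S n) (T n) f) r - trans_op (S n) (Q n k) f r)"
      by (simp add: trans_op_def[of _ "Q n k"] sum_distrib_left sum_subtractf[symmetric]
          right_diff_distrib mult_ac)
    also have "\<dots> = (0 - t * d k) * trans_op (S n) (Q n k) f r
        + t * d k * trans_op (S n) (Q n (k - 1)) f r"
      using c_pos[of n] unfolding * by (simp add: field_simps)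
    finally show ?thesis .
  qed
  \<comment> \<open>The innermost application is split off, so that \<open>Q n k\<close> acts on
    \<open>generator n t f\<close>; hence the induction over all \<open>f\<close>.\<close>
  have "(generator n t ^^ Suc m) f r = (generator n t ^^ m) (generator n t f) r"
    by (simp only: funpow_Suc_right o_apply)
  also have "\<dots> = (\<Sum>k\<le>n. dd_coeff d n (\<lambda>x. (- (t * x)) ^ m) k *
      ((0 - t * d k) * trans_op (S n) (Q n k) f r + t * d k * trans_op (S n) (Q n (k - 1)) f r))"
    unfolding Suc.IH using step by (intro sum.cong) auto
  also have "\<dots> = (\<Sum>k\<le>n. dd_coeff d n (\<lambda>x. (0 - t * x) * (- (t * x)) ^ m) k
      * trans_op (S n) (Q n k) f r)"
    by (rule sum_dd_coeff_affine)
  finally show ?case by simp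
qed

lemma op_exp_generator:
  assumes "r \<in> S n"
  shows "op_exp (generator n t) f r
      = (\<Sum>k\<le>n. dd_coeff d n (\<lambda>x. exp (- (t * x))) k * trans_op (S n) (Q n k) f r)"
proof -
  have "(\<lambda>m. (generator n t ^^ m) f r / fact m)
      = (\<lambda>m. \<Sum>k\<le>n. dd_coeff d n (\<lambda>x. (- (t * x)) ^ m / fact m) k * trans_op (S n) (Q n k) f r)"
    using dd_coeff_cmult[of d n "1 / fact _"]
    by (simp add: funpow_generator[OF assms] sum_divide_distrib)
  moreover have "\<dots> sums (\<Sum>k\<le>n. dd_coeff d n (\<lambda>x. exp (- (t * x))) k * trans_op (S n) (Q n k) f r)"
    by (intro sums_sum sums_mult2 dd_coeff_sums sums_exp)
  ultimately show ?thesis unfolding op_exp_def by (simp only: sums_iff)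
qed

section \<open>Separation distances from an extremal pair\<close>

text \<open>After \<open>n - k < n\<close> steps the death chain is in \<open>k\<close> with
  positive probability. All terms of the mixture are nonnegative and its value at
  \<open>(r, s)\<close> is not positive, so the term of \<open>k\<close> vanishes.\<close>

lemma down_up_eq_0:
  assumes "r \<in> S n" "s \<in> S n" "\<And>m. m < n \<Longrightarrow> \<not> mat_pow (S n) (T n) m r s > 0" "0 < k" "k \<le> n"
  shows "Q n k r s = 0"
proof -
  define a where "a = dd_coeff d n (\<lambda>x. (1 - x / c n) ^ (n - k))"
  have nn: "0 \<le> a i * Q n i r s" if "i \<le> n" for i
    using that assms dd_coeff_power_nonneg down_up_nonneg by (simp add: a_def)
  have "a k * Q n k r s \<le> (\<Sum>i\<le>n. a i * Q n i r s)"
    using nn assms by (intro member_le_sum) auto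
  also have "\<dots> \<le> 0"
    using assms(3)[of "n - k"] assms mat_pow_updown[OF assms(1,2), of "n - k"] by (simp add: a_def)
  finally have "a k * Q n k r s \<le> 0" .
  moreover have "0 < a k" using dd_coeff_power_pos[of "n - k" n] assms by (simp add: a_def)
  ultimately show ?thesis using down_up_nonneg[OF assms(1,2), of k]
    by (simp add: mult_le_0_iff)
qed

text \<open>Dropping the nonnegative terms with \<open>k \<ge> 1\<close> leaves the weight of state
  0 as a lower bound of every quotient; at \<open>(r, s)\<close> these terms are 0 and the bound is
  attained.\<close>

lemma sep_dist_eq:
  assumes r: "r \<in> S n" and s: "s \<in> S n" "M n s > 0"
    and Q: "\<And>k. 0 < k \<Longrightarrow> k \<le> n \<Longrightarrow> Q n k r s = 0"
  shows "sep_dist S e up down n m = 1 - dd_coeff d n (\<lambda>x. (1 - x / c n) ^ m) 0"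
  unfolding sep_dist_def
proof (rule Max_eqI)
  let ?g = "\<lambda>(r, s). 1 - mat_pow (S n) (T n) m r s / M n s"
  let ?X = "{1 - mat_pow (S n) (T n) m r s / M n s | r s. r \<in> S n \<and> s \<in> S n \<and> M n s \<noteq> 0}"
  define a where "a = dd_coeff d n (\<lambda>x. (1 - x / c n) ^ m)"
  have expand: "mat_pow (S n) (T n) m r s = a 0 * M n s + (\<Sum>k=1..n. a k * Q n k r s)"
    if "r \<in> S n" "s \<in> S n" for r s
    using mat_pow_updown[OF that] that by (simp add: a_def sum_atMost_split_0 down_up_0)
  have "?X \<subseteq> ?g ` (S n \<times> S n)" by auto
  then show "finite ?X" by (rule finite_subset) (simp add: fin)
  show "y \<le> 1 - dd_coeff d n (\<lambda>x. (1 - x / c n) ^ m) 0" if "y \<in> ?X" for y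
  proof -
    obtain r s where rs: "r \<in> S n" "s \<in> S n" "M n s \<noteq> 0"
      and y: "y = 1 - mat_pow (S n) (T n) m r s / M n s" using \<open>y \<in> ?X\<close> by blast
    have "0 \<le> (\<Sum>k=1..n. a k * Q n k r s)"
      using dd_coeff_power_nonneg down_up_nonneg rs by (intro sum_nonneg) (simp add: a_def)
    moreover have "M n s > 0" using stat_dist_nonneg[OF rs(2)] rs(3) by simp
    ultimately have "a 0 \<le> mat_pow (S n) (T n) m r s / M n s"
      using expand[OF rs(1,2)] by (simp add: pos_le_divide_eq)
    then show ?thesis by (simp add: y a_def)
  qed
  have "mat_pow (S n) (T n) m r s / M n s = a 0"
    using expand[OF r s(1)] Q s(2) by simp
  then show "1 - dd_coeff d n (\<lambda>x. (1 - x / c n) ^ m) 0 \<in> ?X"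
    using r s by (force simp: a_def)
qed

lemma sep_dist_cont_eq:
  assumes r: "r \<in> S n" and s: "s \<in> S n" "M n s > 0"
    and Q: "\<And>k. 0 < k \<Longrightarrow> k \<le> n \<Longrightarrow> Q n k r s = 0" and t: "t \<ge> 0"
  shows "sep_dist_cont S e up down c n t = 1 - dd_coeff d n (\<lambda>x. exp (- (t * x))) 0"
  unfolding sep_dist_cont_def
proof (rule cSup_eq_non_empty)
  define b where "b = dd_coeff d n (\<lambda>x. exp (- (t * x)))"
  define I where "I f = (\<Sum>s\<in>S n. f s * M n s)" for f
  let ?X = "{1 - op_exp (generator n t) f r / (\<Sum>s\<in>S n. f s * M n s) | r f.
               r \<in> S n \<and> f \<in> S n \<rightarrow> {0<..}}"
  have expand: "op_exp (generator n t) f r = b 0 * I f + (\<Sum>k=1..n. b k * trans_op (S n) (Q n k) f r)"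
    if "r \<in> S n" for r f
    using op_exp_generator[OF that] that
    by (simp add: b_def I_def sum_atMost_split_0) (simp add: trans_op_def down_up_0 mult.commute)
  have I_pos: "I f > 0" if "f \<in> S n \<rightarrow> {0<..}" for f
  proof -
    have pos: "f s > 0" if "s \<in> S n" for s using \<open>f \<in> _\<close> that by auto
    have "0 < f s * M n s" using pos s by simp
    also have "\<dots> \<le> I f" unfolding I_def
      using s fin pos stat_dist_nonneg by (intro member_le_sum) (simp_all add: less_imp_le)
    finally show ?thesis .
  qed
  have b_nonneg: "0 \<le> b k" if "k \<le> n" for k using dd_coeff_exp_nonneg that t by (simp add: b_def)
  have Q_nonneg: "0 \<le> trans_op (S n) (Q n k) f r" if "r \<in> S n" "f \<in> S n \<rightarrow> {0<..}" for k f r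
    unfolding trans_op_def using that down_up_nonneg
    by (intro sum_nonneg mult_nonneg_nonneg) (simp_all add: Pi_iff less_imp_le)
  have "(\<lambda>_. 1) \<in> S n \<rightarrow> {0::real<..}" by simp
  then show "?X \<noteq> {}" using r by blast
  show "y \<le> 1 - dd_coeff d n (\<lambda>x. exp (- (t * x))) 0" if "y \<in> ?X" for y
  proof -
    obtain r f where rf: "r \<in> S n" "f \<in> S n \<rightarrow> {0<..}"
      and y: "y = 1 - op_exp (generator n t) f r / I f" using \<open>y \<in> ?X\<close> unfolding I_def by blast
    have "0 \<le> (\<Sum>k=1..n. b k * trans_op (S n) (Q n k) f r)"
      using b_nonneg Q_nonneg rf by (intro sum_nonneg) simp
    then have "b 0 \<le> op_exp (generator n t) f r / I f"
      using I_pos[OF rf(2)] expand[OF rf(1)] by (simp add: pos_le_divide_eq)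
    then show ?thesis by (simp add: y b_def)
  qed
  show "1 - dd_coeff d n (\<lambda>x. exp (- (t * x))) 0 \<le> z" if ub: "\<And>y. y \<in> ?X \<Longrightarrow> y \<le> z" for z
  proof -
    text \<open>The supremum is approached by \<open>f\<close> tending to the indicator function of \<open>s\<close>.\<close>
    define B where "B = (\<Sum>k=1..n. b k * trans_op (S n) (Q n k) (\<lambda>_. 1) r)"
    have B: "0 \<le> B" unfolding B_def using b_nonneg Q_nonneg[OF r] by (intro sum_nonneg) simp
    have "1 - b 0 \<le> z + \<epsilon> * (B / M n s)" if "\<epsilon> > 0" for \<epsilon>
    proof -
      define f where "f u = \<epsilon> + (if u = s then 1 else 0)" for u
      have f: "f \<in> S n \<rightarrow> {0<..}" using that by (simp add: f_def)
      have "trans_op (S n) (Q n k) f r = \<epsilon> * trans_op (S n) (Q n k) (\<lambda>_. 1) r"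
        if "k \<in> {1..n}" for k
      proof -
        have "trans_op (S n) (Q n k) f r
            = (\<Sum>u\<in>S n. Q n k r u * \<epsilon>) + (\<Sum>u\<in>S n. if u = s then Q n k r u else 0)"
          unfolding trans_op_def f_def sum.distrib[symmetric] by (intro sum.cong) (auto simp: algebra_simps)
        then show ?thesis using Q that s fin by (simp add: trans_op_def sum_distrib_left mult.commute)
      qed
      then have "op_exp (generator n t) f r = b 0 * I f + \<epsilon> * B"
        unfolding expand[OF r] B_def sum_distrib_left by (simp add: mult_ac)
      then have "op_exp (generator n t) f r / I f = b 0 + \<epsilon> * B / I f"
        using I_pos[OF f] by (simp add: field_simps)
      moreover have "1 - op_exp (generator n t) f r / I f \<le> z"
        using r f unfolding I_def by (intro ub) blast
      \<comment> \<open>Bounding \<open>I f\<close> below by \<open>M n s\<close> makes the error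
        linear in \<open>\<epsilon>\<close>.\<close>
      moreover have "\<epsilon> * B / I f \<le> \<epsilon> * B / M n s"
      proof (rule divide_left_mono)
        have "M n s \<le> f s * M n s" using that s by (simp add: f_def)
        also have "\<dots> \<le> I f" unfolding I_def
          using s fin that stat_dist_nonneg by (intro member_le_sum) (auto simp: f_def)
        finally show "M n s \<le> I f" .
        show "0 \<le> \<epsilon> * B" using that B by simp
        show "0 < I f * M n s" using I_pos[OF f] s by simp
      qed
      ultimately show ?thesis by simp
    qed
    then have "((\<lambda>\<epsilon>. z + \<epsilon> * (B / M n s)) \<longlongrightarrow> z + 0 * (B / M n s)) (at_right 0) \<and>
        eventually (\<lambda>\<epsilon>. 1 - b 0 \<le> z + \<epsilon> * (B / M n s)) (at_right 0)"
      by (intro conjI tendsto_intros) (auto simp: eventually_at_filter)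
    then have "1 - b 0 \<le> z + 0 * (B / M n s)"
      by (intro tendsto_lowerbound) auto
    then show ?thesis by (simp add: b_def)
  qed
qed

end

section \<open>Explicit formulas in terms of the rates\<close>

theorem theorem3p20:
  fixes S :: "nat \<Rightarrow> 'a set"
    and e :: 'a
    and up down :: "nat \<Rightarrow> 'a \<Rightarrow> 'a \<Rightarrow> real"
    and \<beta> c :: "nat \<Rightarrow> real"
  assumes "\<And>n. finite (S n)"
    and "disjoint_family S"
    and "S 0 = {e}"
    and "\<And>n. stochastic_matrix (S n) (S (Suc n)) (up n)"
    and "\<And>n. n \<ge> 1 \<Longrightarrow> stochastic_matrix (S n) (S (n - 1)) (down n)"
    and "\<And>n. n \<ge> 1 \<Longrightarrow> 0 < \<beta> n \<and> \<beta> n < 1"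
    and "\<And>n r s. n \<ge> 1 \<Longrightarrow> r \<in> S n \<Longrightarrow> s \<in> S n \<Longrightarrow>
           mat_prod (S (n + 1)) (up n) (down (n + 1)) r s
             = \<beta> n * mat_prod (S (n - 1)) (down n) (up (n - 1)) r s + (1 - \<beta> n) * id_mat r s"
    and "\<And>n. c n > 0"
    and "\<And>n. n \<ge> 1 \<Longrightarrow> c (n - 1) / c n = \<beta> n"
    and "\<And>n. n \<ge> 1 \<Longrightarrow>
           \<exists>r\<in>S n. \<exists>s\<in>S n. stat_dist S e up n s > 0
             \<and> (\<exists>m. mat_pow (S n) (updown_matrix S up down n) m r s > 0)
             \<and> n = (LEAST m. mat_pow (S n) (updown_matrix S up down n) m r s > 0)"
  shows "(\<forall>n\<ge>1. \<forall>m. sep_dist S e up down n m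
            = (\<Sum>i=0..n-1. (1 - c i / c n) ^ m * (\<Prod>j\<in>{0..n-1} - {i}. c j / (c j - c i))))
       \<and> (\<forall>n\<ge>1. \<forall>t\<ge>0. sep_dist_cont S e up down c n t
            = (\<Sum>i=0..n-1. exp (- (c i * t)) * (\<Prod>j\<in>{0..n-1} - {i}. c j / (c j - c i))))"
proof -
  interpret updown_chain S e up down \<beta> c
  proof
    show "updown_matrix S up down (Suc n) r s
        = \<beta> (Suc n) * mat_prod (S n) (down (Suc n)) (up n) r s + (1 - \<beta> (Suc n)) * id_mat r s"
      if "r \<in> S (Suc n)" "s \<in> S (Suc n)" for n r s
      using assms(7)[OF _ that] by (simp add: updown_matrix_def)
    show "c n = \<beta> (Suc n) * c (Suc n)" for n
      using assms(9)[of "Suc n"] assms(8)[of "Suc n"] by (simp add: field_simps)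
    show "stochastic_matrix (S (Suc n)) (S n) (down (Suc n))" for n
      using assms(5)[of "Suc n"] by simp
  qed (rule assms | simp_all add: assms)+
  have extremal: "\<exists>r\<in>S n. \<exists>s\<in>S n. M n s > 0 \<and> (\<forall>k. 0 < k \<longrightarrow> k \<le> n \<longrightarrow> Q n k r s = 0)"
    if n: "n \<ge> 1" for n
  proof -
    obtain r s where rs: "r \<in> S n" "s \<in> S n" "M n s > 0"
      and least: "n = (LEAST m. mat_pow (S n) (T n) m r s > 0)"
      using assms(10)[OF n] by blast
    have "\<not> mat_pow (S n) (T n) m r s > 0" if "m < n" for m
      using that not_less_Least[of m "\<lambda>m. mat_pow (S n) (T n) m r s > 0"] least by metis
    then show ?thesis using rs down_up_eq_0 by metis
  qed
  show ?thesis
  proof (intro conjI allI impI)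
    fix n m :: nat assume n: "n \<ge> 1"
    obtain r s where rs: "r \<in> S n" "s \<in> S n" "M n s > 0"
      and Q: "\<And>k. 0 < k \<Longrightarrow> k \<le> n \<Longrightarrow> Q n k r s = 0"
      using extremal[OF n] by blast
    show "sep_dist S e up down n m
        = (\<Sum>i=0..n-1. (1 - c i / c n) ^ m * (\<Prod>j\<in>{0..n-1} - {i}. c j / (c j - c i)))"
      \<comment> \<open>The function is 1 at the node 0, here and in continuous time, so
        \<open>1 - dd_coeff\<close> leaves exactly the sum.\<close>
      using sep_dist_eq[OF rs Q] dd_coeff_zero[OF assms(8) n, where f = "\<lambda>x. (1 - x / c n) ^ m"]
      by simp
  next
    fix n :: nat and t :: real assume n: "n \<ge> 1" and t: "t \<ge> 0"
    obtain r s where rs: "r \<in> S n" "s \<in> S n" "M n s > 0"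
      and Q: "\<And>k. 0 < k \<Longrightarrow> k \<le> n \<Longrightarrow> Q n k r s = 0"
      using extremal[OF n] by blast
    show "sep_dist_cont S e up down c n t
        = (\<Sum>i=0..n-1. exp (- (c i * t)) * (\<Prod>j\<in>{0..n-1} - {i}. c j / (c j - c i)))"
      using sep_dist_cont_eq[OF rs Q t] dd_coeff_zero[OF assms(8) n, where f = "\<lambda>x. exp (- (t * x))"]
      by (simp add: mult.commute)
  qed
qed

end
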